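(* Let $G$ be a $4$-dimensional real connected Lie group with Lie algebra $\mathfrak g$ determined by a global basis $\{x_1,x_2,x_3,x_4\}$ of left invariant vector fields. Let $q$ be the structure given by $qx_1=x_2$, $qx_2=x_3$, $qx_3=x_4$, $qx_4=x_1$, and let $g$ be the left invariant metric with $g(x_i,x_j)=0$ for $i\neq j$ and $g(x_i,x_i)=1$. Then $(G,g,q)$ is a Riemannian manifold with a circulant structure $q$ and a Killing metric $g$, such that $q$ has the circulant matrix $$(q_i^j)=\begin{pmatrix}0&1&0&0\\0&0&1&0\\0&0&0&1\\1&0&0&0\end{pmatrix}$$ and $g(qx,qy)=g(x,y)$ for all $x,y$, if and only if there exist $\lambda_1,\lambda_2,\lambda_3,\lambda_4\in\mathbb R$ such that $$\begin{aligned} [x_1,x_2]&=\lambda_1x_3+\lambda_2x_4, & [x_1,x_3]&=-\lambda_1x_2+\lambda_4x_4,\\ [x_2,x_3]&=\lambda_1x_1+\lambda_3x_4, & [x_1,x_4]&=-\lambda_2x_2-\lambda_4x_3,\\ [x_2,x_4]&=\lambda_2x_1-\lambda_3x_3, & [x_3,x_4]&=\lambda_4x_1+\lambda_3x_2. \end{aligned}$$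
   Context: The metric $g$ on $G$ is called a Killing metric if $g([x_i,x_j],x_k)+g([x_i,x_k],x_j)=0$ for all $i,j,k\in\{1,2,3,4\}$. The matrix of $q$ is taken with respect to the basis $\{x_i\}$. *)

theory Defs
  imports
    "HOL-Analysis.Analysis"
    "HOL-Library.Function_Algebras"
    "HOL-Algebra.Group"
begin

text \<open>
  Functions into a real vector space form a real vector space pointwise. Tangent vectors are
  functionals on real-valued functions, and vector fields are families of these, so that sums
  and real multiples of both are covered by this instance.
\<close>

instantiation "fun" :: (type, real_vector) real_vector
begin

definition scaleR_fun :: "real \<Rightarrow> ('a \<Rightarrow> 'b) \<Rightarrow> 'a \<Rightarrow> 'b"
  where "scaleR_fun c f = (\<lambda>x. c *\<^sub>R f x)"

instance
  by standard (simp_all add: scaleR_fun_def plus_fun_def fun_eq_iff scaleR_add_right scaleR_add_left)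

end


section \<open>Smooth maps between open subsets of Euclidean spaces\<close>

text \<open>Meant for open \<open>S\<close>: derivatives are taken in the whole space, not within \<open>S\<close>.\<close>

primrec Ck_on :: "nat \<Rightarrow> 'e::euclidean_space set \<Rightarrow> ('e \<Rightarrow> 'f::real_normed_vector) \<Rightarrow> bool"
  where
    "Ck_on 0 S f \<longleftrightarrow> continuous_on S f"
  | "Ck_on (Suc k) S f \<longleftrightarrow>
       (\<forall>x\<in>S. f differentiable (at x)) \<and>
       (\<forall>v. Ck_on k S (\<lambda>x. frechet_derivative f (at x) v))"

definition smooth_on :: "'e::euclidean_space set \<Rightarrow> ('e \<Rightarrow> 'f::real_normed_vector) \<Rightarrow> bool"
  where "smooth_on S f \<longleftrightarrow> (\<forall>k. Ck_on k S f)"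


section \<open>Smooth manifolds\<close>

text \<open>
  A chart is a pair of its domain and its coordinate map; the values of the coordinate map
  outside the domain are irrelevant. The atlas need not be maximal.
\<close>

type_synonym ('a, 'e) chart = "'a set \<times> ('a \<Rightarrow> 'e)"

locale smooth_manifold =
  fixes T :: "'a topology"
    and A :: "('a, 'e::euclidean_space) chart set"
  assumes hausdorff: "Hausdorff_space T"
    and second_countable: "second_countable T"
    and chart: "\<And>U \<phi>. (U, \<phi>) \<in> A \<Longrightarrow>
          openin T U \<and> open (\<phi> ` U) \<and>
          homeomorphic_map (subtopology T U) (top_of_set (\<phi> ` U)) \<phi>"
    and cover: "topspace T = (\<Union>(U, \<phi>)\<in>A. U)"
    and compatible: "\<And>U \<phi> V \<psi>. (U, \<phi>) \<in> A \<Longrightarrow> (V, \<psi>) \<in> A \<Longrightarrow>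
          smooth_on (\<phi> ` (U \<inter> V)) (\<psi> \<circ> inv_into U \<phi>)"

definition smooth_map ::
  "'a topology \<Rightarrow> ('a, 'e::euclidean_space) chart set \<Rightarrow>
   'b topology \<Rightarrow> ('b, 'f::euclidean_space) chart set \<Rightarrow> ('a \<Rightarrow> 'b) \<Rightarrow> bool"
  where "smooth_map T A T' A' F \<longleftrightarrow>
    continuous_map T T' F \<and>
    (\<forall>(U, \<phi>)\<in>A. \<forall>(V, \<psi>)\<in>A'. smooth_on (\<phi> ` (U \<inter> F -` V)) (\<psi> \<circ> F \<circ> inv_into U \<phi>))"

definition prod_atlas ::
  "('a, 'e::euclidean_space) chart set \<Rightarrow> ('b, 'f::euclidean_space) chart set \<Rightarrow>
   ('a \<times> 'b, 'e \<times> 'f) chart set"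
  where "prod_atlas A B = {(U \<times> V, map_prod \<phi> \<psi>) |U \<phi> V \<psi>. (U, \<phi>) \<in> A \<and> (V, \<psi>) \<in> B}"

definition smooth_funs :: "('a, 'e::euclidean_space) chart set \<Rightarrow> ('a \<Rightarrow> real) set"
  where "smooth_funs A = {f. \<forall>(U, \<phi>)\<in>A. smooth_on (\<phi> ` U) (f \<circ> inv_into U \<phi>)}"


section \<open>Tangent vectors and tensor fields\<close>

text \<open>
  Tangent vectors at a point are derivations there. They are set to 0 on functions that are not
  smooth, and vector fields are set to 0 at points outside the manifold, so that equality of
  tangent vectors and of vector fields is equality in HOL.
\<close>

type_synonym 'a tangent = "('a \<Rightarrow> real) \<Rightarrow> real"
type_synonym 'a vfield = "'a \<Rightarrow> 'a tangent"

definition tangent_space ::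
  "('a, 'e::euclidean_space) chart set \<Rightarrow> 'a \<Rightarrow> 'a tangent set"
  where "tangent_space A p = {v.
    (\<forall>f\<in>smooth_funs A. \<forall>h\<in>smooth_funs A. v (f + h) = v f + v h) \<and>
    (\<forall>c. \<forall>f\<in>smooth_funs A. v (c *\<^sub>R f) = c * v f) \<and>
    (\<forall>f\<in>smooth_funs A. \<forall>h\<in>smooth_funs A. v (f * h) = f p * v h + h p * v f) \<and>
    (\<forall>f. f \<notin> smooth_funs A \<longrightarrow> v f = 0)}"

definition vector_fields ::
  "'a topology \<Rightarrow> ('a, 'e::euclidean_space) chart set \<Rightarrow> 'a vfield set"
  where "vector_fields T A = {X.
    (\<forall>p\<in>topspace T. X p \<in> tangent_space A p) \<and>
    (\<forall>p. p \<notin> topspace T \<longrightarrow> X p = 0) \<and>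
    (\<forall>f\<in>smooth_funs A. (\<lambda>p. X p f) \<in> smooth_funs A)}"

definition lie_bracket :: "'a vfield \<Rightarrow> 'a vfield \<Rightarrow> 'a vfield"
  where "lie_bracket X Y = (\<lambda>p f. X p (\<lambda>r. Y r f) - Y p (\<lambda>r. X r f))"

definition differential ::
  "('b, 'f::euclidean_space) chart set \<Rightarrow> ('a \<Rightarrow> 'b) \<Rightarrow> 'a tangent \<Rightarrow> 'b tangent"
  where "differential B F v = (\<lambda>f. if f \<in> smooth_funs B then v (f \<circ> F) else 0)"

text \<open>A global frame: at every point the members form a basis of the tangent space.\<close>

definition global_frame ::
  "'a topology \<Rightarrow> ('a, 'e::euclidean_space) chart set \<Rightarrow> ('i \<Rightarrow> 'a vfield) \<Rightarrow> bool"
  where "global_frame T A x \<longleftrightarrow>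
    (\<forall>i. x i \<in> vector_fields T A) \<and>
    (\<forall>p\<in>topspace T.
       inj (\<lambda>i. x i p) \<and> independent (range (\<lambda>i. x i p)) \<and>
       span (range (\<lambda>i. x i p)) = tangent_space A p)"

definition apply_endo ::
  "'a topology \<Rightarrow> ('a \<Rightarrow> 'a tangent \<Rightarrow> 'a tangent) \<Rightarrow> 'a vfield \<Rightarrow> 'a vfield"
  where "apply_endo T q X = (\<lambda>p. if p \<in> topspace T then q p (X p) else 0)"

text \<open>Smooth tensor fields of type (1,1), i.e. fields of endomorphisms of the tangent spaces.\<close>

definition endo_field ::
  "'a topology \<Rightarrow> ('a, 'e::euclidean_space) chart set \<Rightarrow>
   ('a \<Rightarrow> 'a tangent \<Rightarrow> 'a tangent) \<Rightarrow> bool"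
  where "endo_field T A q \<longleftrightarrow>
    (\<forall>p\<in>topspace T. \<forall>u\<in>tangent_space A p.
       q p u \<in> tangent_space A p \<and>
       (\<forall>v\<in>tangent_space A p. q p (u + v) = q p u + q p v) \<and>
       (\<forall>c. q p (c *\<^sub>R u) = c *\<^sub>R q p u)) \<and>
    (\<forall>X\<in>vector_fields T A. apply_endo T q X \<in> vector_fields T A)"

text \<open>Smooth tensor fields of type (0,2).\<close>

definition bilinear_field ::
  "'a topology \<Rightarrow> ('a, 'e::euclidean_space) chart set \<Rightarrow>
   ('a \<Rightarrow> 'a tangent \<Rightarrow> 'a tangent \<Rightarrow> real) \<Rightarrow> bool"
  where "bilinear_field T A g \<longleftrightarrow>
    (\<forall>p\<in>topspace T. \<forall>u\<in>tangent_space A p. \<forall>v\<in>tangent_space A p.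
       (\<forall>w\<in>tangent_space A p.
          g p (u + v) w = g p u w + g p v w \<and> g p w (u + v) = g p w u + g p w v) \<and>
       (\<forall>c. g p (c *\<^sub>R u) v = c * g p u v \<and> g p u (c *\<^sub>R v) = c * g p u v)) \<and>
    (\<forall>X\<in>vector_fields T A. \<forall>Y\<in>vector_fields T A.
       (\<lambda>p. g p (X p) (Y p)) \<in> smooth_funs A)"

definition riemannian_metric ::
  "'a topology \<Rightarrow> ('a, 'e::euclidean_space) chart set \<Rightarrow>
   ('a \<Rightarrow> 'a tangent \<Rightarrow> 'a tangent \<Rightarrow> real) \<Rightarrow> bool"
  where "riemannian_metric T A g \<longleftrightarrow>
    bilinear_field T A g \<and>
    (\<forall>p\<in>topspace T. \<forall>u\<in>tangent_space A p.
       (\<forall>v\<in>tangent_space A p. g p u v = g p v u) \<and>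
       (u \<noteq> 0 \<longrightarrow> g p u u > 0))"

definition riemannian_manifold ::
  "'a topology \<Rightarrow> ('a, 'e::euclidean_space) chart set \<Rightarrow>
   ('a \<Rightarrow> 'a tangent \<Rightarrow> 'a tangent \<Rightarrow> real) \<Rightarrow> bool"
  where "riemannian_manifold T A g \<longleftrightarrow> smooth_manifold T A \<and> riemannian_metric T A g"

definition endo_isometric ::
  "'a topology \<Rightarrow> ('a, 'e::euclidean_space) chart set \<Rightarrow>
   ('a \<Rightarrow> 'a tangent \<Rightarrow> 'a tangent \<Rightarrow> real) \<Rightarrow> ('a \<Rightarrow> 'a tangent \<Rightarrow> 'a tangent) \<Rightarrow> bool"
  where "endo_isometric T A g q \<longleftrightarrow>
    (\<forall>p\<in>topspace T. \<forall>u\<in>tangent_space A p. \<forall>v\<in>tangent_space A p.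
       g p (q p u) (q p v) = g p u v)"


section \<open>Circulant structures\<close>

text \<open>
  Row convention: the entry in row i and column j is the coefficient of the j-th frame field in
  the image of the i-th one. Indices live in the numeral type 4, whose addition is modulo 4.
\<close>

definition has_matrix ::
  "'a topology \<Rightarrow> ('a \<Rightarrow> 'a tangent \<Rightarrow> 'a tangent) \<Rightarrow> ('n::finite \<Rightarrow> 'a vfield) \<Rightarrow>
   real^'n^'n \<Rightarrow> bool"
  where "has_matrix T q x C \<longleftrightarrow> (\<forall>i. apply_endo T q (x i) = (\<Sum>j\<in>UNIV. C $ i $ j *\<^sub>R x j))"

definition circulant_matrix :: "real^4^4 \<Rightarrow> bool"
  where "circulant_matrix C \<longleftrightarrow> (\<forall>i j. C $ (i + 1) $ (j + 1) = C $ i $ j)"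

definition circulant_structure ::
  "'a topology \<Rightarrow> ('a, 'e::euclidean_space) chart set \<Rightarrow> (4 \<Rightarrow> 'a vfield) \<Rightarrow>
   ('a \<Rightarrow> 'a tangent \<Rightarrow> 'a tangent) \<Rightarrow> bool"
  where "circulant_structure T A x q \<longleftrightarrow>
    endo_field T A q \<and> (\<exists>C. circulant_matrix C \<and> has_matrix T q x C)"

definition shift_matrix :: "real^4^4"
  where "shift_matrix = vector
    [vector [0, 1, 0, 0],
     vector [0, 0, 1, 0],
     vector [0, 0, 0, 1],
     vector [1, 0, 0, 0]]"


section \<open>Lie groups\<close>

locale lie_group = group G + smooth_manifold T A
  for G :: "('a, 'b) monoid_scheme" (structure)
    and T :: "'a topology"
    and A :: "('a, 'e::euclidean_space) chart set" +
  assumes topspace_carrier: "topspace T = carrier G"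
    and smooth_mult: "smooth_map (prod_topology T T) (prod_atlas A A) T A (\<lambda>(a, b). a \<otimes> b)"
    and smooth_inv: "smooth_map T A T A (\<lambda>a. inv a)"

definition left_translation :: "('a, 'b) monoid_scheme \<Rightarrow> 'a \<Rightarrow> 'a \<Rightarrow> 'a"
  where "left_translation G a = (\<lambda>p. a \<otimes>\<^bsub>G\<^esub> p)"

text \<open>The Lie algebra of left invariant vector fields; its bracket is \<open>lie_bracket\<close>.\<close>

definition lie_algebra ::
  "('a, 'b) monoid_scheme \<Rightarrow> 'a topology \<Rightarrow> ('a, 'e::euclidean_space) chart set \<Rightarrow> 'a vfield set"
  where "lie_algebra G T A = {X \<in> vector_fields T A.
    \<forall>a\<in>carrier G. \<forall>p\<in>carrier G.
      X (a \<otimes>\<^bsub>G\<^esub> p) = differential A (left_translation G a) (X p)}"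

definition left_invariant_form ::
  "('a, 'b) monoid_scheme \<Rightarrow> ('a, 'e::euclidean_space) chart set \<Rightarrow>
   ('a \<Rightarrow> 'a tangent \<Rightarrow> 'a tangent \<Rightarrow> real) \<Rightarrow> bool"
  where "left_invariant_form G A g \<longleftrightarrow>
    (\<forall>a\<in>carrier G. \<forall>p\<in>carrier G. \<forall>u\<in>tangent_space A p. \<forall>v\<in>tangent_space A p.
       g (a \<otimes>\<^bsub>G\<^esub> p) (differential A (left_translation G a) u)
                  (differential A (left_translation G a) v) = g p u v)"

definition killing_metric ::
  "('a, 'b) monoid_scheme \<Rightarrow> ('a \<Rightarrow> 'a tangent \<Rightarrow> 'a tangent \<Rightarrow> real) \<Rightarrow>
   (4 \<Rightarrow> 'a vfield) \<Rightarrow> bool"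
  where "killing_metric G g x \<longleftrightarrow>
    (\<forall>i j k. \<forall>p\<in>carrier G.
       g p (lie_bracket (x i) (x j) p) (x k p) + g p (lie_bracket (x i) (x k) p) (x j p) = 0)"

end

theory Submission
  imports Defs
begin

text \<open>
  The tensor part of the equivalence does not restrict the bracket. An orthonormal global frame
  expands every tangent vector with its \<open>g\<close>-products as coefficients (\<open>frame_expansion\<close>), so \<open>g\<close> is
  symmetric and positive definite, and \<open>q\<close>, which permutes the frame cyclically, is an isometry
  with the shift matrix. What remains is that the Killing condition is equivalent to the six
  bracket relations.

  The bracket of two frame fields is again a field of derivations (\<open>lie_bracket_tangent\<close>) and left
  invariant (\<open>lie_bracket_left_invariant\<close>). Since left translations act transitively and preserve
  \<open>g\<close> and the frame, its coordinates in the frame are the same at every point: they are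
  structure constants \<open>c i j k\<close> (\<open>structure_const_at\<close>, \<open>lie_bracket_frame\<close>). The bracket is skew,
  so \<open>c\<close> is skew in \<open>i, j\<close>; the Killing condition says precisely that \<open>c\<close> is skew in \<open>j, k\<close>. Both
  together say that \<open>c\<close> is an alternating form on a four-dimensional space in three arguments, and
  such a form is given by the four numbers \<open>c 1 2 3\<close>, \<open>c 1 2 4\<close>, \<open>c 2 3 4\<close>, \<open>c 1 3 4\<close>. These are
  \<open>l1\<close>, \<open>l2\<close>, \<open>l3\<close>, \<open>l4\<close> (\<open>bracket_relations_if_alternating\<close>). Conversely, the relations
  display all structure constants, and the required skewness can be read off.

  The analysis needed is modest. The Leibniz rule for the bracket uses that products of smooth
  functions are smooth. Left invariance of the bracket uses that a tangent vector does not see the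
  values of a function outside the manifold (\<open>tangent_cong\<close>).
\<close>

section \<open>The algebra of smooth functions\<close>

lemma frechet_derivative_cong_open:
  assumes "open S" "x \<in> S" and eq: "\<And>y. y \<in> S \<Longrightarrow> f y = h y"
  shows "frechet_derivative f (at x) = frechet_derivative h (at x)"
proof -
  have "(f has_derivative D) (at x) \<longleftrightarrow> (h has_derivative D) (at x)" for D
    using assms by (metis has_derivative_transform_within_open)
  then show ?thesis
    by (simp add: frechet_derivative_def)
qed

lemma differentiable_cong_open:
  assumes "open S" "x \<in> S" and eq: "\<And>y. y \<in> S \<Longrightarrow> f y = h y"
  shows "f differentiable (at x) \<longleftrightarrow> h differentiable (at x)"
  using assms unfolding differentiable_def by (metis has_derivative_transform_within_open)

text \<open>
  The iterated derivatives in \<open>Ck_on\<close> are total functions whose values outside \<open>S\<close> are arbitrary;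
  on an open set they can be replaced by any formula valid there, such as the product rule.
\<close>

lemma Ck_on_cong:
  assumes "open S" and "\<And>y. y \<in> S \<Longrightarrow> f y = h y"
  shows "Ck_on k S f \<longleftrightarrow> Ck_on k S h"
  using assms(2)
proof (induction k arbitrary: f h)
  case 0
  then show ?case by (simp cong: continuous_on_cong)
next
  case (Suc k)
  have "Ck_on k S (\<lambda>x. frechet_derivative f (at x) v) \<longleftrightarrow>
        Ck_on k S (\<lambda>x. frechet_derivative h (at x) v)" for v
    by (rule Suc.IH) (use frechet_derivative_cong_open[OF assms(1) _ Suc.prems] in simp)
  then show ?case
    using differentiable_cong_open[OF assms(1) _ Suc.prems] by auto
qed

lemma Ck_on_const: "Ck_on k S (\<lambda>x. c)"
  by (induction k arbitrary: c) (simp_all add: frechet_derivative_const)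

lemma Ck_on_Suc_imp: "Ck_on (Suc k) S f \<Longrightarrow> Ck_on k S f"
proof (induction k arbitrary: f)
  case 0
  then show ?case
    by (simp add: differentiable_imp_continuous_on differentiable_at_imp_differentiable_on)
next
  case (Suc k)
  then show ?case by simp
qed

lemma Ck_on_add:
  assumes "open S" "Ck_on k S f" "Ck_on k S h"
  shows "Ck_on k S (\<lambda>x. f x + h x)"
  using assms(2,3)
proof (induction k arbitrary: f h)
  case 0
  then show ?case by (simp add: continuous_on_add)
next
  case (Suc k)
  have "Ck_on k S (\<lambda>x. frechet_derivative (\<lambda>x. f x + h x) (at x) v)" for v
  proof -
    have "Ck_on k S (\<lambda>x. frechet_derivative f (at x) v + frechet_derivative h (at x) v)"
      using Suc by simp
    moreover have "frechet_derivative (\<lambda>x. f x + h x) (at y) v =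
        frechet_derivative f (at y) v + frechet_derivative h (at y) v" if "y \<in> S" for y
    proof -
      have "((\<lambda>x. f x + h x) has_derivative
          (\<lambda>v. frechet_derivative f (at y) v + frechet_derivative h (at y) v)) (at y)"
        using Suc.prems that by (intro has_derivative_add) (simp_all add: frechet_derivative_works)
      then show ?thesis
        by (simp flip: frechet_derivative_at)
    qed
    ultimately show ?thesis
      using assms(1) by (subst Ck_on_cong) auto
  qed
  then show ?case
    using Suc.prems by (simp add: differentiable_add)
qed

lemma Ck_on_mult:
  fixes f h :: "'e::euclidean_space \<Rightarrow> 'f::real_normed_algebra"
  assumes "open S" "Ck_on k S f" "Ck_on k S h"
  shows "Ck_on k S (\<lambda>x. f x * h x)"
  using assms(2,3)
proof (induction k arbitrary: f h)
  case 0
  then show ?case by (simp add: continuous_on_mult)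
next
  case (Suc k)
  have "Ck_on k S (\<lambda>x. frechet_derivative (\<lambda>x. f x * h x) (at x) v)" for v
  proof -
    have "Ck_on k S (\<lambda>x. f x * frechet_derivative h (at x) v + frechet_derivative f (at x) v * h x)"
      using Suc.prems Ck_on_Suc_imp[OF Suc.prems(1)] Ck_on_Suc_imp[OF Suc.prems(2)]
      by (intro Ck_on_add[OF assms(1)] Suc.IH) simp_all
    moreover have "frechet_derivative (\<lambda>x. f x * h x) (at y) v =
        f y * frechet_derivative h (at y) v + frechet_derivative f (at y) v * h y" if "y \<in> S" for y
    proof -
      have "((\<lambda>x. f x * h x) has_derivative
          (\<lambda>v. f y * frechet_derivative h (at y) v + frechet_derivative f (at y) v * h y)) (at y)"
        using Suc.prems that by (intro has_derivative_mult) (simp_all add: frechet_derivative_works)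
      then show ?thesis
        by (simp flip: frechet_derivative_at)
    qed
    ultimately show ?thesis
      using assms(1) by (subst Ck_on_cong) auto
  qed
  then show ?case
    using Suc.prems by (simp add: differentiable_mult)
qed

context smooth_manifold
begin

lemma chart_open: "(U, \<phi>) \<in> A \<Longrightarrow> open (\<phi> ` U)"
  and chart_subset: "(U, \<phi>) \<in> A \<Longrightarrow> U \<subseteq> topspace T"
  using chart openin_subset by blast+

lemma smooth_funs_const: "(\<lambda>p. c) \<in> smooth_funs A"
  by (auto simp: smooth_funs_def smooth_on_def o_def Ck_on_const)

lemma smooth_funs_add: "f \<in> smooth_funs A \<Longrightarrow> h \<in> smooth_funs A \<Longrightarrow> f + h \<in> smooth_funs A"
  unfolding smooth_funs_def smooth_on_def
  by (fastforce simp: o_def plus_fun_def intro: Ck_on_add chart_open)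

lemma smooth_funs_mult: "f \<in> smooth_funs A \<Longrightarrow> h \<in> smooth_funs A \<Longrightarrow> f * h \<in> smooth_funs A"
  unfolding smooth_funs_def smooth_on_def
  by (fastforce simp: o_def times_fun_def intro: Ck_on_mult chart_open)

lemma smooth_funs_scaleR: "f \<in> smooth_funs A \<Longrightarrow> c *\<^sub>R f \<in> smooth_funs A"
  using smooth_funs_mult[OF smooth_funs_const[of c], of f]
  by (simp add: scaleR_fun_def times_fun_def)

text \<open>
  Chart domains lie in the manifold, so smoothness leaves the values elsewhere free. In particular
  every function that is constant on the manifold is smooth.
\<close>

lemma smooth_funs_cong:
  assumes "f \<in> smooth_funs A" and eq: "\<And>p. p \<in> topspace T \<Longrightarrow> f p = h p"
  shows "h \<in> smooth_funs A"
proof -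
  have "Ck_on k (\<phi> ` U) (h \<circ> inv_into U \<phi>)" if "(U, \<phi>) \<in> A" for U \<phi> k
  proof -
    have "Ck_on k (\<phi> ` U) (f \<circ> inv_into U \<phi>) \<longleftrightarrow> Ck_on k (\<phi> ` U) (h \<circ> inv_into U \<phi>)"
      using chart_subset[OF that] eq
      by (intro Ck_on_cong[OF chart_open[OF that]]) (simp add: inv_into_into subset_iff)
    then show ?thesis
      using assms(1) that by (auto simp: smooth_funs_def smooth_on_def)
  qed
  then show ?thesis
    by (auto simp: smooth_funs_def smooth_on_def)
qed


section \<open>Tangent vectors and the bracket\<close>

lemma tangent_add:
  "v \<in> tangent_space A p \<Longrightarrow> f \<in> smooth_funs A \<Longrightarrow> h \<in> smooth_funs A \<Longrightarrow> v (f + h) = v f + v h"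
  and tangent_scaleR:
  "v \<in> tangent_space A p \<Longrightarrow> f \<in> smooth_funs A \<Longrightarrow> v (c *\<^sub>R f) = c * v f"
  and tangent_mult:
  "v \<in> tangent_space A p \<Longrightarrow> f \<in> smooth_funs A \<Longrightarrow> h \<in> smooth_funs A \<Longrightarrow>
    v (f * h) = f p * v h + h p * v f"
  and tangent_nonsmooth: "v \<in> tangent_space A p \<Longrightarrow> f \<notin> smooth_funs A \<Longrightarrow> v f = 0"
  by (auto simp: tangent_space_def)

lemma tangent_zero:
  assumes "v \<in> tangent_space A p"
  shows "v (\<lambda>r. 0) = 0"
  using tangent_scaleR[OF assms smooth_funs_const, of 0 0] by (simp add: scaleR_fun_def)

lemma vector_field_tangent:
  "X \<in> vector_fields T A \<Longrightarrow> p \<in> topspace T \<Longrightarrow> X p \<in> tangent_space A p"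
  and vector_field_outside: "X \<in> vector_fields T A \<Longrightarrow> p \<notin> topspace T \<Longrightarrow> X p = 0"
  and vector_field_smooth:
  "X \<in> vector_fields T A \<Longrightarrow> f \<in> smooth_funs A \<Longrightarrow> (\<lambda>p. X p f) \<in> smooth_funs A"
  by (auto simp: vector_fields_def)

lemma vector_field_nonsmooth:
  assumes "X \<in> vector_fields T A" "f \<notin> smooth_funs A"
  shows "X p f = 0"
  using assms vector_field_tangent vector_field_outside tangent_nonsmooth
  by (cases "p \<in> topspace T") (metis, metis zero_fun_def)

text \<open>
  The difference of the two functions vanishes on the manifold, so it equals its product with the
  indicator of the complement. Both factors are smooth and vanish at \<open>p\<close>, so the Leibniz rule gives 0.
\<close>

lemma tangent_cong:
  assumes v: "v \<in> tangent_space A p" and p: "p \<in> topspace T"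
    and f: "f \<in> smooth_funs A" and eq: "\<And>r. r \<in> topspace T \<Longrightarrow> f r = h r"
  shows "v f = v h"
proof -
  have h: "h \<in> smooth_funs A"
    using smooth_funs_cong[OF f] eq by simp
  define d where "d = h + (-1) *\<^sub>R f"
  define e :: "'a \<Rightarrow> real" where "e r = (if r \<in> topspace T then 0 else 1)" for r
  have d: "d \<in> smooth_funs A"
    unfolding d_def by (intro smooth_funs_add smooth_funs_scaleR f h)
  have e: "e \<in> smooth_funs A"
    by (rule smooth_funs_cong[OF smooth_funs_const[of 0]]) (simp add: e_def)
  have d0: "d r = 0" if "r \<in> topspace T" for r
    using eq[OF that] by (simp add: d_def scaleR_fun_def)
  have "d = d * e"
    using d0 by (auto simp: e_def fun_eq_iff)
  then have "v d = 0"
    using tangent_mult[OF v d e] d0[OF p] p by (simp add: e_def)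
  moreover have "v d = v h + (-1) * v f"
    unfolding d_def by (simp only: tangent_add[OF v h smooth_funs_scaleR[OF f]] tangent_scaleR[OF v f])
  ultimately show ?thesis by simp
qed

text \<open>
  In \<open>X (Y (f h)) - Y (X (f h))\<close> the mixed terms \<open>X f * Y h + Y f * X h\<close> are symmetric in \<open>X\<close> and
  \<open>Y\<close> and cancel, which leaves the Leibniz rule for the bracket.
\<close>

lemma lie_bracket_tangent:
  assumes X: "X \<in> vector_fields T A" and Y: "Y \<in> vector_fields T A" and p: "p \<in> topspace T"
  shows "lie_bracket X Y p \<in> tangent_space A p"
proof -
  note Xp = vector_field_tangent[OF X p] and Yp = vector_field_tangent[OF Y p]
  have add: "Z r (f + h) = Z r f + Z r h"
    and scale: "Z r (c *\<^sub>R f) = c * Z r f"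
    and mult: "r \<in> topspace T \<Longrightarrow> Z r (f * h) = f r * Z r h + h r * Z r f"
    if "Z \<in> vector_fields T A" "f \<in> smooth_funs A" "h \<in> smooth_funs A" for Z r f h c
    using that vector_field_tangent[of Z r] vector_field_outside[of Z r]
    by (cases "r \<in> topspace T"; simp add: tangent_add tangent_scaleR tangent_mult)+
  have fadd: "(\<lambda>r. Z r (f + h)) = (\<lambda>r. Z r f) + (\<lambda>r. Z r h)"
    and fscale: "(\<lambda>r. Z r (c *\<^sub>R f)) = c *\<^sub>R (\<lambda>r. Z r f)"
    if "Z \<in> vector_fields T A" "f \<in> smooth_funs A" "h \<in> smooth_funs A" for Z f h c
    using add[OF that] scale[OF that] by (auto simp: scaleR_fun_def)
  have comp_mult: "v (\<lambda>r. Z r (f * h)) =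
      f p * v (\<lambda>r. Z r h) + Z p h * v f + (h p * v (\<lambda>r. Z r f) + Z p f * v h)"
    if v: "v \<in> tangent_space A p" and Z: "Z \<in> vector_fields T A"
      and f: "f \<in> smooth_funs A" and h: "h \<in> smooth_funs A" for v Z f h
  proof -
    note Zf = vector_field_smooth[OF Z f] and Zh = vector_field_smooth[OF Z h]
    \<comment> \<open>The two arguments agree on the manifold only, where the Leibniz rule for \<open>Z r\<close> holds.\<close>
    have "v (\<lambda>r. Z r (f * h)) = v (f * (\<lambda>r. Z r h) + h * (\<lambda>r. Z r f))"
      by (rule tangent_cong[OF v p])
        (use mult[OF Z f h] in \<open>simp_all add: vector_field_smooth[OF Z] smooth_funs_mult f h\<close>)
    also have "\<dots> = v (f * (\<lambda>r. Z r h)) + v (h * (\<lambda>r. Z r f))"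
      by (rule tangent_add[OF v]) (simp_all add: smooth_funs_mult f h Zf Zh)
    finally show ?thesis
      by (simp add: tangent_mult[OF v f Zh] tangent_mult[OF v h Zf])
  qed
  show ?thesis
    unfolding tangent_space_def lie_bracket_def mem_Collect_eq
  proof (intro conjI ballI allI impI)
    fix f h assume f: "f \<in> smooth_funs A" and h: "h \<in> smooth_funs A"
    show "X p (\<lambda>r. Y r (f + h)) - Y p (\<lambda>r. X r (f + h)) =
        X p (\<lambda>r. Y r f) - Y p (\<lambda>r. X r f) + (X p (\<lambda>r. Y r h) - Y p (\<lambda>r. X r h))"
      unfolding fadd[OF X f h] fadd[OF Y f h]
      using tangent_add[OF Xp vector_field_smooth[OF Y f] vector_field_smooth[OF Y h]]
        tangent_add[OF Yp vector_field_smooth[OF X f] vector_field_smooth[OF X h]]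
      by linarith
    show "X p (\<lambda>r. Y r (f * h)) - Y p (\<lambda>r. X r (f * h)) =
        f p * (X p (\<lambda>r. Y r h) - Y p (\<lambda>r. X r h)) + h p * (X p (\<lambda>r. Y r f) - Y p (\<lambda>r. X r f))"
      by (simp add: comp_mult[OF Xp Y f h] comp_mult[OF Yp X f h] algebra_simps)
  next
    fix c f assume f: "f \<in> smooth_funs A"
    show "X p (\<lambda>r. Y r (c *\<^sub>R f)) - Y p (\<lambda>r. X r (c *\<^sub>R f)) =
        c * (X p (\<lambda>r. Y r f) - Y p (\<lambda>r. X r f))"
      unfolding fscale[OF X f f] fscale[OF Y f f]
      using tangent_scaleR[OF Xp vector_field_smooth[OF Y f]]
        tangent_scaleR[OF Yp vector_field_smooth[OF X f]]
      by (simp add: right_diff_distrib)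
  next
    fix f assume "f \<notin> smooth_funs A"
    then show "X p (\<lambda>r. Y r f) - Y p (\<lambda>r. X r f) = 0"
      by (simp add: vector_field_nonsmooth X Y tangent_zero[OF Xp] tangent_zero[OF Yp])
  qed
qed

lemma lie_bracket_outside:
  assumes "X \<in> vector_fields T A" "Y \<in> vector_fields T A" "p \<notin> topspace T"
  shows "lie_bracket X Y p = 0"
  using assms by (simp add: lie_bracket_def vector_field_outside fun_eq_iff)

end

lemma sum_apply: "(\<Sum>i\<in>I. F i) p = (\<Sum>i\<in>I. F i p)"
proof (induction I rule: infinite_finite_induct)
  case (insert i I)
  then show ?case by (subst (1 2) sum.insert) auto
qed simp_all

lemma lie_bracket_skew: "lie_bracket Y X = - lie_bracket X Y"
  by (simp add: lie_bracket_def fun_eq_iff)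

context lie_group
begin

lemma left_invariant_vector_field: "X \<in> lie_algebra G T A \<Longrightarrow> X \<in> vector_fields T A"
  by (simp add: lie_algebra_def)

lemma left_invariant_apply:
  assumes "X \<in> lie_algebra G T A" "a \<in> carrier G" "p \<in> carrier G" "f \<in> smooth_funs A"
  shows "X (a \<otimes> p) f = X p (f \<circ> left_translation G a)"
  using assms by (simp add: lie_algebra_def differential_def)

text \<open>
  On the group, \<open>(Y f) \<circ> L\<close> agrees with \<open>Y (f \<circ> L)\<close> for a left translation \<open>L\<close>. The latter
  function is smooth in any case: if \<open>f \<circ> L\<close> is not smooth, then it is 0, because \<open>Y\<close> is set to 0 on
  functions that are not smooth. Hence both have the same derivative along \<open>X p\<close>.
\<close>

lemma left_invariant_iterate:
  assumes X: "X \<in> lie_algebra G T A" and Y: "Y \<in> lie_algebra G T A"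
    and a: "a \<in> carrier G" and p: "p \<in> carrier G" and f: "f \<in> smooth_funs A"
  shows "X (a \<otimes> p) (\<lambda>r. Y r f) = X p (\<lambda>r. Y r (f \<circ> left_translation G a))"
proof -
  let ?L = "left_translation G a"
  note XV = left_invariant_vector_field[OF X] and YV = left_invariant_vector_field[OF Y]
  have smooth: "(\<lambda>r. Y r (f \<circ> ?L)) \<in> smooth_funs A"
  proof (cases "f \<circ> ?L \<in> smooth_funs A")
    case True
    then show ?thesis by (rule vector_field_smooth[OF YV])
  next
    case False
    then show ?thesis by (simp add: vector_field_nonsmooth[OF YV] smooth_funs_const)
  qed
  have "X (a \<otimes> p) (\<lambda>r. Y r f) = X p ((\<lambda>r. Y r f) \<circ> ?L)"
    by (rule left_invariant_apply[OF X a p vector_field_smooth[OF YV f]])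
  also have "\<dots> = X p (\<lambda>r. Y r (f \<circ> ?L))"
  proof (rule tangent_cong[of "X p" p, symmetric])
    show "X p \<in> tangent_space A p" "p \<in> topspace T"
      using XV p topspace_carrier by (auto intro: vector_field_tangent)
    show "(\<lambda>r. Y r (f \<circ> ?L)) \<in> smooth_funs A" by (rule smooth)
    show "Y r (f \<circ> ?L) = ((\<lambda>r. Y r f) \<circ> ?L) r" if "r \<in> topspace T" for r
      using left_invariant_apply[OF Y a _ f, of r] that topspace_carrier
      by (simp add: left_translation_def)
  qed
  finally show ?thesis .
qed

lemma lie_bracket_left_invariant:
  assumes X: "X \<in> lie_algebra G T A" and Y: "Y \<in> lie_algebra G T A"
    and a: "a \<in> carrier G" and p: "p \<in> carrier G"
  shows "lie_bracket X Y (a \<otimes> p) = differential A (left_translation G a) (lie_bracket X Y p)"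
proof
  fix f
  note XV = left_invariant_vector_field[OF X] and YV = left_invariant_vector_field[OF Y]
  show "lie_bracket X Y (a \<otimes> p) f = differential A (left_translation G a) (lie_bracket X Y p) f"
  proof (cases "f \<in> smooth_funs A")
    case True
    then show ?thesis
      using left_invariant_iterate[OF X Y a p] left_invariant_iterate[OF Y X a p]
      by (simp add: differential_def lie_bracket_def)
  next
    case False
    have "lie_bracket X Y (a \<otimes> p) \<in> tangent_space A (a \<otimes> p)"
      using a p topspace_carrier by (intro lie_bracket_tangent[OF XV YV]) simp
    then show ?thesis
      using False by (simp add: differential_def tangent_nonsmooth)
  qed
qed

end


section \<open>Orthonormal frames\<close>

lemma linear_on_subspace_sum:
  fixes f :: "'v::real_vector \<Rightarrow> 'w::real_vector"
  assumes S: "subspace S"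
    and add: "\<And>u v. u \<in> S \<Longrightarrow> v \<in> S \<Longrightarrow> f (u + v) = f u + f v"
    and scale: "\<And>c u. u \<in> S \<Longrightarrow> f (c *\<^sub>R u) = c *\<^sub>R f u"
    and u: "\<And>i. i \<in> I \<Longrightarrow> u i \<in> S"
  shows "f (\<Sum>i\<in>I. a i *\<^sub>R u i) = (\<Sum>i\<in>I. a i *\<^sub>R f (u i))"
proof -
  have zero: "f 0 = 0"
    using scale[OF subspace_0[OF S], of 0] by simp
  show ?thesis
    using u
  proof (induction I rule: infinite_finite_induct)
    case (insert i I)
    then have "(\<Sum>i\<in>I. a i *\<^sub>R u i) \<in> S"
      by (intro subspace_sum subspace_scale S) auto
    then show ?case
      using insert by (simp add: add scale subspace_scale[OF S])
  qed (simp_all add: zero)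
qed

locale orthonormal_frame = smooth_manifold T A
  for T :: "'a topology" and A :: "('a, 'e::euclidean_space) chart set" +
  fixes x :: "'n::finite \<Rightarrow> 'a vfield"
    and g :: "'a \<Rightarrow> 'a tangent \<Rightarrow> 'a tangent \<Rightarrow> real"
  assumes frame: "global_frame T A x"
    and form: "bilinear_field T A g"
    and orthonormal: "\<And>p i j. p \<in> topspace T \<Longrightarrow> g p (x i p) (x j p) = (if i = j then 1 else 0)"
begin

lemma frame_vector_field: "x i \<in> vector_fields T A"
  using frame by (simp add: global_frame_def)

lemma frame_tangent: "p \<in> topspace T \<Longrightarrow> x i p \<in> tangent_space A p"
  by (rule vector_field_tangent[OF frame_vector_field])

lemma frame_span: "p \<in> topspace T \<Longrightarrow> span (range (\<lambda>i. x i p)) = tangent_space A p"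
  using frame by (simp add: global_frame_def)

lemma subspace_tangent: "p \<in> topspace T \<Longrightarrow> subspace (tangent_space A p)"
  using frame_span subspace_span by metis

lemma form_sum_left:
  assumes p: "p \<in> topspace T" and v: "v \<in> tangent_space A p"
    and u: "\<And>i. i \<in> I \<Longrightarrow> u i \<in> tangent_space A p"
  shows "g p (\<Sum>i\<in>I. a i *\<^sub>R u i) v = (\<Sum>i\<in>I. a i * g p (u i) v)"
proof -
  have "g p (\<Sum>i\<in>I. a i *\<^sub>R u i) v = (\<Sum>i\<in>I. a i *\<^sub>R g p (u i) v)"
    using form p v u unfolding bilinear_field_def
    by (intro linear_on_subspace_sum[where f = "\<lambda>u. g p u v", OF subspace_tangent[OF p]];
        (simp only: real_scaleR_def)?; blast)
  then show ?thesis by simp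
qed

lemma form_sum_right:
  assumes p: "p \<in> topspace T" and v: "v \<in> tangent_space A p"
    and u: "\<And>i. i \<in> I \<Longrightarrow> u i \<in> tangent_space A p"
  shows "g p v (\<Sum>i\<in>I. a i *\<^sub>R u i) = (\<Sum>i\<in>I. a i * g p v (u i))"
proof -
  have "g p v (\<Sum>i\<in>I. a i *\<^sub>R u i) = (\<Sum>i\<in>I. a i *\<^sub>R g p v (u i))"
    using form p v u unfolding bilinear_field_def
    by (intro linear_on_subspace_sum[where f = "g p v", OF subspace_tangent[OF p]];
        (simp only: real_scaleR_def)?; blast)
  then show ?thesis by simp
qed

lemma form_frame_coordinate:
  assumes p: "p \<in> topspace T"
  shows "g p (\<Sum>i\<in>UNIV. a i *\<^sub>R x i p) (x j p) = a j"
  by (simp add: form_sum_left[OF p frame_tangent[OF p] frame_tangent[OF p]] orthonormal[OF p]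
      if_distrib[of "\<lambda>t. _ * t"] cong: if_cong)

lemma form_coordinates:
  assumes p: "p \<in> topspace T"
  shows "g p (\<Sum>i\<in>UNIV. a i *\<^sub>R x i p) (\<Sum>i\<in>UNIV. b i *\<^sub>R x i p) = (\<Sum>i\<in>UNIV. a i * b i)"
proof -
  have "(\<Sum>i\<in>UNIV. a i *\<^sub>R x i p) \<in> tangent_space A p"
    by (intro subspace_sum subspace_scale subspace_tangent[OF p] frame_tangent[OF p])
  then show ?thesis
    by (simp add: form_sum_right[OF p _ frame_tangent[OF p]] form_frame_coordinate[OF p] mult.commute)
qed

lemma frame_expansion:
  assumes p: "p \<in> topspace T" and u: "u \<in> tangent_space A p"
  shows "u = (\<Sum>i\<in>UNIV. g p u (x i p) *\<^sub>R x i p)"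
proof -
  have inj: "inj (\<lambda>i. x i p)"
    using frame p by (simp add: global_frame_def)
  have "u \<in> span (range (\<lambda>i. x i p))"
    using u frame_span[OF p] by simp
  then obtain a where "u = (\<Sum>v\<in>range (\<lambda>i. x i p). a v *\<^sub>R v)"
    by (auto simp: span_finite)
  then have a: "u = (\<Sum>i\<in>UNIV. a (x i p) *\<^sub>R x i p)"
    by (simp add: sum.reindex[OF inj])
  then have "g p u (x i p) = a (x i p)" for i
    using form_frame_coordinate[OF p, of "\<lambda>i. a (x i p)"] by simp
  then show ?thesis
    using a by simp
qed

lemma obtain_coordinates:
  assumes "p \<in> topspace T" and "u \<in> tangent_space A p"
  obtains a where "u = (\<Sum>i\<in>UNIV. a i *\<^sub>R x i p)"
  using frame_expansion[OF assms] that by metis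

lemma riemannian: "riemannian_metric T A g"
  unfolding riemannian_metric_def
proof (intro conjI ballI impI)
  show "bilinear_field T A g" by (rule form)
next
  fix p u v assume p: "p \<in> topspace T" and u: "u \<in> tangent_space A p" and v: "v \<in> tangent_space A p"
  obtain a b where "u = (\<Sum>i\<in>UNIV. a i *\<^sub>R x i p)" "v = (\<Sum>i\<in>UNIV. b i *\<^sub>R x i p)"
    using obtain_coordinates[OF p u] obtain_coordinates[OF p v] by metis
  then show "g p u v = g p v u"
    by (simp add: form_coordinates[OF p] mult.commute)
next
  fix p u assume p: "p \<in> topspace T" and u: "u \<in> tangent_space A p" and nz: "u \<noteq> 0"
  obtain a where a: "u = (\<Sum>i\<in>UNIV. a i *\<^sub>R x i p)"
    using obtain_coordinates[OF p u] .
  have "\<exists>i. a i \<noteq> 0"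
  proof (rule ccontr)
    assume "\<not> (\<exists>i. a i \<noteq> 0)"
    then have "u = 0" by (simp add: a)
    with nz show False by simp
  qed
  then obtain i where "a i \<noteq> 0" ..
  then have "0 < (\<Sum>i\<in>UNIV. a i * a i)"
    by (intro sum_pos2[of UNIV i]) (auto simp: zero_less_mult_iff)
  then show "g p u u > 0"
    by (simp add: a form_coordinates[OF p])
qed

lemma endo_sum:
  assumes q: "endo_field T A q" and p: "p \<in> topspace T"
    and u: "\<And>i. i \<in> I \<Longrightarrow> u i \<in> tangent_space A p"
  shows "q p (\<Sum>i\<in>I. a i *\<^sub>R u i) = (\<Sum>i\<in>I. a i *\<^sub>R q p (u i))"
  using q p u unfolding endo_field_def
  by (intro linear_on_subspace_sum[where f = "q p", OF subspace_tangent[OF p]]) blast+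

text \<open>A permutation of the coordinates leaves the sum of their products unchanged.\<close>

lemma permuting_endo_isometric:
  assumes q: "endo_field T A q" and \<sigma>: "bij \<sigma>" and perm: "\<And>i. apply_endo T q (x i) = x (\<sigma> i)"
  shows "endo_isometric T A g q"
  unfolding endo_isometric_def
proof (intro ballI)
  fix p u v assume p: "p \<in> topspace T" and u: "u \<in> tangent_space A p" and v: "v \<in> tangent_space A p"
  have qx: "q p (x i p) = x (\<sigma> i) p" for i
    using fun_cong[OF perm, of i p] p by (simp add: apply_endo_def)
  have q_sum: "q p (\<Sum>i\<in>UNIV. a i *\<^sub>R x i p) = (\<Sum>i\<in>UNIV. a (inv_into UNIV \<sigma> i) *\<^sub>R x i p)" for a
    using sum.reindex_bij_betw[OF \<sigma>, of "\<lambda>i. a (inv_into UNIV \<sigma> i) *\<^sub>R x i p"]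
    by (simp add: endo_sum[OF q p frame_tangent[OF p]] qx bij_is_inj[OF \<sigma>])
  obtain a b where ab: "u = (\<Sum>i\<in>UNIV. a i *\<^sub>R x i p)" "v = (\<Sum>i\<in>UNIV. b i *\<^sub>R x i p)"
    using obtain_coordinates[OF p u] obtain_coordinates[OF p v] by metis
  have "(\<Sum>i\<in>UNIV. a (inv_into UNIV \<sigma> i) * b (inv_into UNIV \<sigma> i)) = (\<Sum>i\<in>UNIV. a i * b i)"
    using sum.reindex_bij_betw[OF \<sigma>, of "\<lambda>i. a (inv_into UNIV \<sigma> i) * b (inv_into UNIV \<sigma> i)"]
    by (simp add: bij_is_inj[OF \<sigma>])
  then show "g p (q p u) (q p v) = g p u v"
    by (simp add: ab q_sum form_coordinates[OF p])
qed

end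


section \<open>Structure constants\<close>

locale left_invariant_orthonormal_frame =
  lie_group G T A + orthonormal_frame T A x g
  for G :: "('a, 'b) monoid_scheme" (structure) and T :: "'a topology"
    and A :: "('a, 'e::euclidean_space) chart set"
    and x :: "'n::finite \<Rightarrow> 'a vfield"
    and g :: "'a \<Rightarrow> 'a tangent \<Rightarrow> 'a tangent \<Rightarrow> real" +
  assumes left_invariant_frame: "\<And>i. x i \<in> lie_algebra G T A"
    and left_invariant_form: "left_invariant_form G A g"
begin

text \<open>
  The value at the unit element stands for the value at every point, because the left translation
  by \<open>p\<close> carries the bracket, the frame and the form from the unit to \<open>p\<close>.
\<close>

definition structure_const :: "'n \<Rightarrow> 'n \<Rightarrow> 'n \<Rightarrow> real"
  where "structure_const i j k = g \<one> (lie_bracket (x i) (x j) \<one>) (x k \<one>)"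

lemma structure_const_at:
  assumes p: "p \<in> carrier G"
  shows "g p (lie_bracket (x i) (x j) p) (x k p) = structure_const i j k"
proof -
  let ?D = "differential A (left_translation G p)"
  have one: "\<one> \<in> topspace T"
    by (simp add: topspace_carrier)
  have "lie_bracket (x i) (x j) p = ?D (lie_bracket (x i) (x j) \<one>)"
    using lie_bracket_left_invariant[OF left_invariant_frame left_invariant_frame p one_closed] p
    by simp
  moreover have "x k p = ?D (x k \<one>)"
  proof -
    have "x k (p \<otimes> \<one>) = ?D (x k \<one>)"
      using left_invariant_frame[of k] p unfolding lie_algebra_def by blast
    then show ?thesis using p by simp
  qed
  moreover have "g (p \<otimes> \<one>) (?D (lie_bracket (x i) (x j) \<one>)) (?D (x k \<one>)) = structure_const i j k"
    using left_invariant_form p lie_bracket_tangent[OF frame_vector_field frame_vector_field one]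
      frame_tangent[OF one] unfolding left_invariant_form_def structure_const_def by blast
  ultimately show ?thesis using p by simp
qed

lemma lie_bracket_frame:
  "lie_bracket (x i) (x j) = (\<Sum>k\<in>UNIV. structure_const i j k *\<^sub>R x k)"
proof
  fix p
  show "lie_bracket (x i) (x j) p = (\<Sum>k\<in>UNIV. structure_const i j k *\<^sub>R x k) p"
  proof (cases "p \<in> topspace T")
    case True
    have "lie_bracket (x i) (x j) p = (\<Sum>k\<in>UNIV. structure_const i j k *\<^sub>R x k p)"
      using frame_expansion[OF True lie_bracket_tangent[OF frame_vector_field frame_vector_field True]]
        structure_const_at True topspace_carrier by simp
    then show ?thesis
      by (simp add: sum_apply scaleR_fun_def)
  next
    case False
    then have "(c *\<^sub>R x k) p = 0" for c k
      by (simp add: vector_field_outside[OF frame_vector_field] scaleR_fun_def fun_eq_iff)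
    then show ?thesis
      using False by (simp add: lie_bracket_outside frame_vector_field sum_apply)
  qed
qed

lemma structure_const_skew: "structure_const j i k = - structure_const i j k"
proof -
  note 1 = lie_bracket_tangent[OF frame_vector_field[of i] frame_vector_field[of j]]
  have one: "\<one> \<in> topspace T"
    by (simp add: topspace_carrier)
  have "g \<one> ((-1) *\<^sub>R lie_bracket (x i) (x j) \<one>) (x k \<one>) =
      (-1) * g \<one> (lie_bracket (x i) (x j) \<one>) (x k \<one>)"
    using form 1[OF one] frame_tangent[OF one] one unfolding bilinear_field_def by blast
  then show ?thesis
    by (simp add: structure_const_def lie_bracket_skew[of "x j" "x i"])
qed

lemma structure_const_two_terms:
  assumes "lie_bracket (x i) (x j) = a *\<^sub>R x m + b *\<^sub>R x n"
  shows "structure_const i j k = (if m = k then a else 0) + (if n = k then b else 0)"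
proof -
  have one: "\<one> \<in> topspace T"
    by (simp add: topspace_carrier)
  have "lie_bracket (x i) (x j) \<one> = a *\<^sub>R x m \<one> + b *\<^sub>R x n \<one>"
    unfolding assms by (simp add: scaleR_fun_def)
  moreover have "g \<one> (a *\<^sub>R x m \<one> + b *\<^sub>R x n \<one>) (x k \<one>) =
      g \<one> (a *\<^sub>R x m \<one>) (x k \<one>) + g \<one> (b *\<^sub>R x n \<one>) (x k \<one>)"
    using form one frame_tangent[OF one] subspace_scale[OF subspace_tangent[OF one]]
    unfolding bilinear_field_def by blast
  moreover have "g \<one> (c *\<^sub>R x l \<one>) (x k \<one>) = c * g \<one> (x l \<one>) (x k \<one>)" for c l
    using form one frame_tangent[OF one] unfolding bilinear_field_def by blast
  ultimately show ?thesis
    by (simp add: structure_const_def orthonormal[OF one])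
qed

end


section \<open>The shift structure in dimension four\<close>

lemma vector_4:
  "(vector [a, b, c, d] :: 'a::zero^4) $ 1 = a"
  "(vector [a, b, c, d] :: 'a^4) $ 2 = b"
  "(vector [a, b, c, d] :: 'a^4) $ 3 = c"
  "(vector [a, b, c, d] :: 'a^4) $ 4 = d"
  unfolding vector_def by simp_all

text \<open>The simplifier evaluates \<open>4 + 1\<close> to the numeral \<open>5\<close>, so the wrap-around needs this equation.\<close>

lemma five_eq_one: "(5 :: 4) = 1"
  by simp

lemma circulant_shift_matrix: "circulant_matrix shift_matrix"
  by (simp add: five_eq_one circulant_matrix_def shift_matrix_def forall_4 vector_4)

lemma has_matrix_shift:
  assumes "\<And>i. apply_endo T q (x i) = x (i + 1)"
  shows "has_matrix T q x shift_matrix"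
proof -
  have "x (i + 1) = (\<Sum>j\<in>UNIV. shift_matrix $ i $ j *\<^sub>R x j)" for i
    using exhaust_4[of i]
    by (elim disjE; simp only: sum_4 shift_matrix_def vector_4 scaleR_zero_left scaleR_one
        add_0_left add_0_right) (simp_all add: five_eq_one)
  then show ?thesis
    unfolding has_matrix_def by (intro allI trans[OF assms])
qed

text \<open>
  The bracket is skew in \<open>i, j\<close> and the Killing condition is skewness in \<open>j, k\<close>. Together they
  make the structure constants alternating: they vanish at repeated indices, and at distinct ones
  they are determined up to sign by the set of the three indices. There are four such sets.
\<close>

lemma bracket_relations_if_alternating:
  fixes x :: "4 \<Rightarrow> 'a vfield" and c :: "4 \<Rightarrow> 4 \<Rightarrow> 4 \<Rightarrow> real"
  assumes bracket: "\<And>i j. lie_bracket (x i) (x j) = (\<Sum>k\<in>UNIV. c i j k *\<^sub>R x k)"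
    and skew12: "\<And>i j k. c j i k = - c i j k" and skew23: "\<And>i j k. c i k j = - c i j k"
  shows "lie_bracket (x 1) (x 2) = c 1 2 3 *\<^sub>R x 3 + c 1 2 4 *\<^sub>R x 4"
    and "lie_bracket (x 1) (x 3) = - c 1 2 3 *\<^sub>R x 2 + c 1 3 4 *\<^sub>R x 4"
    and "lie_bracket (x 2) (x 3) = c 1 2 3 *\<^sub>R x 1 + c 2 3 4 *\<^sub>R x 4"
    and "lie_bracket (x 1) (x 4) = - c 1 2 4 *\<^sub>R x 2 - c 1 3 4 *\<^sub>R x 3"
    and "lie_bracket (x 2) (x 4) = c 1 2 4 *\<^sub>R x 1 - c 2 3 4 *\<^sub>R x 3"
    and "lie_bracket (x 3) (x 4) = c 1 3 4 *\<^sub>R x 1 + c 2 3 4 *\<^sub>R x 2"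
proof -
  have zero: "c i j j = 0" "c i j i = 0" for i j
    using skew23[of i j j] skew23[of i j i] skew12[of i i j] by linarith+
  have sorted:
    "c 1 3 2 = - c 1 2 3" "c 2 3 1 = c 1 2 3" "c 1 4 2 = - c 1 2 4" "c 1 4 3 = - c 1 3 4"
    "c 2 4 1 = c 1 2 4" "c 2 4 3 = - c 2 3 4" "c 3 4 1 = c 1 3 4" "c 3 4 2 = c 2 3 4"
    using skew12 skew23 by (metis minus_minus)+
  note simps = bracket sum_4 zero sorted scaleR_zero_left add_0_left add_0_right
    scaleR_minus_left diff_conv_add_uminus
  show "lie_bracket (x 1) (x 2) = c 1 2 3 *\<^sub>R x 3 + c 1 2 4 *\<^sub>R x 4"
    "lie_bracket (x 1) (x 3) = - c 1 2 3 *\<^sub>R x 2 + c 1 3 4 *\<^sub>R x 4"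
    "lie_bracket (x 2) (x 3) = c 1 2 3 *\<^sub>R x 1 + c 2 3 4 *\<^sub>R x 4"
    "lie_bracket (x 1) (x 4) = - c 1 2 4 *\<^sub>R x 2 - c 1 3 4 *\<^sub>R x 3"
    "lie_bracket (x 2) (x 4) = c 1 2 4 *\<^sub>R x 1 - c 2 3 4 *\<^sub>R x 3"
    "lie_bracket (x 3) (x 4) = c 1 3 4 *\<^sub>R x 1 + c 2 3 4 *\<^sub>R x 2"
    by (simp_all only: simps)
qed

theorem theorem3p1:
  fixes G :: "('a, 'b) monoid_scheme"
    and T :: "'a topology"
    and A :: "('a, real^4) chart set"
    and x :: "4 \<Rightarrow> 'a vfield"
    and q :: "'a \<Rightarrow> 'a tangent \<Rightarrow> 'a tangent"
    and g :: "'a \<Rightarrow> 'a tangent \<Rightarrow> 'a tangent \<Rightarrow> real"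
  assumes "lie_group G T A"
    and "connected_space T"
    and "\<And>i. x i \<in> lie_algebra G T A"
    and "global_frame T A x"
    and "endo_field T A q"
    and "apply_endo T q (x 1) = x 2" "apply_endo T q (x 2) = x 3"
      "apply_endo T q (x 3) = x 4" "apply_endo T q (x 4) = x 1"
    and "bilinear_field T A g"
    and "left_invariant_form G A g"
    and "\<And>i j p. p \<in> carrier G \<Longrightarrow> i \<noteq> j \<Longrightarrow> g p (x i p) (x j p) = 0"
    and "\<And>i p. p \<in> carrier G \<Longrightarrow> g p (x i p) (x i p) = 1"
  shows
    "(riemannian_manifold T A g \<and>
      circulant_structure T A x q \<and>
      killing_metric G g x \<and>
      has_matrix T q x shift_matrix \<and>
      endo_isometric T A g q)
     \<longleftrightarrow>
     (\<exists>l1 l2 l3 l4 :: real.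
        lie_bracket (x 1) (x 2) = l1 *\<^sub>R x 3 + l2 *\<^sub>R x 4 \<and>
        lie_bracket (x 1) (x 3) = - l1 *\<^sub>R x 2 + l4 *\<^sub>R x 4 \<and>
        lie_bracket (x 2) (x 3) = l1 *\<^sub>R x 1 + l3 *\<^sub>R x 4 \<and>
        lie_bracket (x 1) (x 4) = - l2 *\<^sub>R x 2 - l4 *\<^sub>R x 3 \<and>
        lie_bracket (x 2) (x 4) = l2 *\<^sub>R x 1 - l3 *\<^sub>R x 3 \<and>
        lie_bracket (x 3) (x 4) = l4 *\<^sub>R x 1 + l3 *\<^sub>R x 2)"
    (is "?structure \<longleftrightarrow> ?relations")
proof -
  interpret lie_group G T A by (rule assms(1))
  interpret left_invariant_orthonormal_frame G T A x g
    using assms(3,4,10-13) by unfold_locales (auto simp: topspace_carrier)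
  have shift: "apply_endo T q (x i) = x (i + 1)" for i
    using exhaust_4[of i] by (elim disjE) (simp_all add: assms(6-9) five_eq_one)
  have "bij (\<lambda>i::4. i + 1)"
    by (rule bij_betw_byWitness[where f' = "\<lambda>i. i - 1"]) auto
  then have tensors: "riemannian_manifold T A g" "circulant_structure T A x q"
    "has_matrix T q x shift_matrix" "endo_isometric T A g q"
    using smooth_manifold_axioms riemannian has_matrix_shift[of T q x, OF shift]
      circulant_shift_matrix assms(5) permuting_endo_isometric[OF assms(5) _ shift]
    by (auto simp: riemannian_manifold_def circulant_structure_def)
  have killing: "killing_metric G g x \<longleftrightarrow>
      (\<forall>i j k. structure_const i j k + structure_const i k j = 0)"
    using structure_const_at one_closed unfolding killing_metric_def by metis
  have "killing_metric G g x \<longleftrightarrow> ?relations"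
  proof
    assume "killing_metric G g x"
    then have "structure_const i k j = - structure_const i j k" for i j k
      using killing by (metis add.commute eq_neg_iff_add_eq_0)
    note relations = bracket_relations_if_alternating[OF lie_bracket_frame structure_const_skew this]
    show ?relations
      by (intro exI conjI) (rule relations)+
  next
    assume ?relations
    then obtain l1 l2 l3 l4 where "lie_bracket (x 1) (x 2) = l1 *\<^sub>R x 3 + l2 *\<^sub>R x 4"
        "lie_bracket (x 1) (x 3) = - l1 *\<^sub>R x 2 + l4 *\<^sub>R x 4"
        "lie_bracket (x 2) (x 3) = l1 *\<^sub>R x 1 + l3 *\<^sub>R x 4"
        "lie_bracket (x 1) (x 4) = - l2 *\<^sub>R x 2 + (- l4) *\<^sub>R x 3"
        "lie_bracket (x 2) (x 4) = l2 *\<^sub>R x 1 + (- l3) *\<^sub>R x 3"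
        "lie_bracket (x 3) (x 4) = l4 *\<^sub>R x 1 + l3 *\<^sub>R x 2"
      unfolding diff_conv_add_uminus scaleR_minus_left by blast
    \<comment> \<open>Each relation has exactly two terms, which gives \<open>c i j k\<close> for six pairs \<open>i, j\<close>;
      skewness gives the reversed pairs and the equal ones.\<close>
    note upper = this[THEN structure_const_two_terms]
    have diagonal: "structure_const i i k = 0" for i k
      using structure_const_skew[of i i k] by simp
    note lower = structure_const_skew[of 2 1] structure_const_skew[of 3 1] structure_const_skew[of 3 2]
      structure_const_skew[of 4 1] structure_const_skew[of 4 2] structure_const_skew[of 4 3]
    show "killing_metric G g x"
      unfolding killing forall_4 by (simp add: upper lower diagonal)
  qed
  then show ?thesis
    using tensors by blast
qed

end
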